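(* For every integer $t\ge 0$, if $G$ is a $t$-dominating graph, then there is a $0$-dominating graph $H$ with $V(H)=V(G)$ such that the local difference between $G$ and $H$ is at most $646t^4$.
   Context: All graphs are finite and have no loops or parallel edges. A vertex $u$ of a graph $t$-dominates a vertex $v$ if there are at most $t$ vertices different from $u,v$ that are adjacent to $v$ and not adjacent to $u$. A graph is $t$-dominating if for every pair of distinct vertices, one of them $t$-dominates the other. For graphs $G,H$ on the same vertex set, the local difference between $G$ and $H$ is the maximum over all vertices $v$ of $|N_G(v)\setminus N_H(v)|+|N_H(v)\setminus N_G(v)|$, where $N_G(v),N_H(v)$ denote the sets of neighbours of $v$ in $G,H$ respectively. *)

theory Defs
  imports "Graph_Theory.Pair_Digraph"
begin

text \<open>
  A finite simple graph is a \<^locale>\<open>pair_graph\<close>: a finite loopless digraph without parallel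
  arcs whose arc relation is symmetric. The null graph is allowed.
\<close>

definition nbhd :: "'a pair_pre_digraph \<Rightarrow> 'a \<Rightarrow> 'a set" where
  "nbhd G v = {w \<in> pverts G. (v, w) \<in> parcs G}"

definition t_dominates :: "'a pair_pre_digraph \<Rightarrow> nat \<Rightarrow> 'a \<Rightarrow> 'a \<Rightarrow> bool" where
  "t_dominates G t u v \<longleftrightarrow>
     card {w \<in> pverts G. w \<noteq> u \<and> w \<noteq> v \<and> w \<in> nbhd G v \<and> w \<notin> nbhd G u} \<le> t"

definition t_dominating :: "'a pair_pre_digraph \<Rightarrow> nat \<Rightarrow> bool" where
  "t_dominating G t \<longleftrightarrow>
     (\<forall>u \<in> pverts G. \<forall>v \<in> pverts G. u \<noteq> v \<longrightarrow> t_dominates G t u v \<or> t_dominates G t v u)"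

text \<open>
  Meant for finite graphs on a common vertex set. Inserting \<open>0\<close> affects only the null graph,
  where the maximum would otherwise be over the empty set.
\<close>

definition local_difference :: "'a pair_pre_digraph \<Rightarrow> 'a pair_pre_digraph \<Rightarrow> nat" where
  "local_difference G H =
     Max (insert 0 ((\<lambda>v. card (nbhd G v - nbhd H v) + card (nbhd H v - nbhd G v)) ` pverts G))"

end

theory Submission
  imports Defs
begin

text \<open>
  Rank the vertices by decreasing degree, so that earlier vertices \<open>t\<close>-dominate later ones. If
  \<open>G\<close> were a threshold graph, \<open>a\<close> and \<open>j\<close> would be adjacent when the degree of \<open>j\<close>
  exceeds the rank of \<open>a\<close> and non-adjacent when it is smaller; in general each \<open>a\<close> has only
  \<open>O(t)\<close> exceptions with \<open>\<bar>d j - r a\<bar> > 2t + 1\<close>. Correcting these in every row gives sets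
  \<open>B a\<close>; let \<open>s j\<close> be the number of rows \<open>B a\<close> containing \<open>j\<close>, which is within \<open>O(t)\<close>
  of the degree. If \<open>j\<close> is missing from row \<open>a\<close>, \<open>k\<close> is in it and \<open>s k \<le> s j\<close>, then
  some row \<open>b\<close> contains \<open>j\<close> but not \<open>k\<close>, and the correction forces the ranks of \<open>a\<close> and
  \<open>b\<close> to be within \<open>O(t)\<close>. Domination between the rows \<open>a\<close> and \<open>b\<close> therefore
  leaves only \<open>O(t\<^sup>2)\<close> such \<open>j\<close> or \<open>k\<close>, and every neighbourhood is within
  \<open>O(t\<^sup>2)\<close> of an upper level set of the single weight \<open>s\<close>. Making these level sets
  monotone and symmetric turns them into a threshold graph, with local difference
  \<open>O(t\<^sup>2)\<close>.
\<close>

section \<open>Double counting, extremal elements and rankings\<close>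

lemma double_count_le:
  assumes "finite A" "finite B"
    and "\<And>a. a \<in> A \<Longrightarrow> m \<le> card {b \<in> B. R a b}"
    and "\<And>b. b \<in> B \<Longrightarrow> card {a \<in> A. R a b} \<le> k"
  shows "card A * m \<le> card B * k"
proof -
  have "card A * m \<le> (\<Sum>a\<in>A. card {b \<in> B. R a b})"
    using sum_bounded_below[of A m "\<lambda>a. card {b \<in> B. R a b}"] assms(3) by simp
  also have "\<dots> = (\<Sum>a\<in>A. \<Sum>b\<in>B. if R a b then 1 else 0)"
    using assms(2) by (simp add: sum.If_cases Int_def)
  also have "\<dots> = (\<Sum>b\<in>B. \<Sum>a\<in>A. if R a b then 1 else 0)"
    by (rule sum.swap)
  also have "\<dots> = (\<Sum>b\<in>B. card {a \<in> A. R a b})"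
    using assms(1) by (simp add: sum.If_cases Int_def)
  also have "\<dots> \<le> card B * k"
    using sum_bounded_above[of B "\<lambda>b. card {a \<in> A. R a b}" k] assms(4) by simp
  finally show ?thesis .
qed

lemma ex_image_minimizer:
  fixes f :: "'a \<Rightarrow> 'b::linorder"
  assumes "finite A" "A \<noteq> {}"
  obtains k where "k \<in> A" "\<And>j. j \<in> A \<Longrightarrow> f k \<le> f j"
proof -
  have "Min (f ` A) \<in> f ` A" using assms by (intro Min_in) auto
  then obtain k where k: "k \<in> A" "Min (f ` A) = f k" by blast
  have "f k \<le> f j" if "j \<in> A" for j
    unfolding k(2)[symmetric] using assms(1) that by (intro Min_le) auto
  with k(1) show ?thesis using that by blast
qed

lemma ex_image_maximizer:
  fixes f :: "'a \<Rightarrow> 'b::linorder"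
  assumes "finite A" "A \<noteq> {}"
  obtains k where "k \<in> A" "\<And>j. j \<in> A \<Longrightarrow> f j \<le> f k"
proof -
  have "Max (f ` A) \<in> f ` A" using assms by (intro Max_in) auto
  then obtain k where k: "k \<in> A" "Max (f ` A) = f k" by blast
  have "f j \<le> f k" if "j \<in> A" for j
    unfolding k(2)[symmetric] using assms(1) that by (intro Max_ge) auto
  with k(1) show ?thesis using that by blast
qed

lemma ex_rank_decreasing:
  fixes d :: "'a \<Rightarrow> nat"
  assumes "finite V"
  shows "\<exists>r. bij_betw r V {..<card V} \<and> (\<forall>u\<in>V. \<forall>v\<in>V. r u < r v \<longrightarrow> d v \<le> d u)"
proof -
  obtain xs where xs: "set xs = V" "distinct xs"
    using finite_distinct_list[OF assms] by blast
  define ys where "ys = sort_key (\<lambda>v. - int (d v)) xs"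
  have ys: "set ys = V" "distinct ys" and len: "length ys = card V"
    using xs by (auto simp: ys_def distinct_card)
  have srt: "sorted (map (\<lambda>v. - int (d v)) ys)"
    by (simp add: ys_def)
  have bij: "bij_betw ((!) ys) {..<card V} V"
    using bij_betw_nth[OF ys(2) refl ys(1)[symmetric]] len by simp
  define r where "r = inv_into {..<card V} ((!) ys)"
  have "bij_betw r V {..<card V}"
    unfolding r_def by (rule bij_betw_inv_into[OF bij])
  moreover have "d v \<le> d u" if "u \<in> V" "v \<in> V" "r u < r v" for u v
  proof -
    have lt: "r v < length ys"
      using calculation that(2) len by (auto simp: bij_betw_def)
    have nth: "ys ! r u = u" "ys ! r v = v"
      using that bij unfolding r_def by (simp_all add: bij_betw_inv_into_right)
    have "- int (d (ys ! r u)) \<le> - int (d (ys ! r v))"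
      using sorted_nth_mono[OF srt, of "r u" "r v"] that(3) lt by simp
    then show ?thesis using nth by simp
  qed
  ultimately show ?thesis by blast
qed

section \<open>Domination expressed through degrees\<close>

locale dominating_nbhds =
  fixes V :: "'a set" and N :: "'a \<Rightarrow> 'a set" and t :: nat
  assumes finV: "finite V"
    and N_sub: "\<And>v. v \<in> V \<Longrightarrow> N v \<subseteq> V"
    and N_irrefl: "\<And>v. v \<notin> N v"
    and N_sym: "\<And>u v. u \<in> N v \<Longrightarrow> v \<in> N u"
    and dom: "\<And>u v. u \<in> V \<Longrightarrow> v \<in> V \<Longrightarrow> u \<noteq> v \<Longrightarrow>
      card (N v - N u - {u}) \<le> t \<or> card (N u - N v - {v}) \<le> t"
begin

abbreviation d :: "'a \<Rightarrow> nat" where "d v \<equiv> card (N v)"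

lemma finN: "v \<in> V \<Longrightarrow> finite (N v)"
  using N_sub finV finite_subset by blast

text \<open>If \<open>d v \<le> d u\<close>, then \<open>N v - N u\<close> is no larger than
  \<open>N u - N v\<close>. By symmetry, deleting \<open>u\<close> from the first and
  \<open>v\<close> from the second has an effect on both or on neither, so either alternative of
  \<open>dom\<close> gives the bound.\<close>

lemma card_diff_le_of_degree_le:
  assumes "u \<in> V" "v \<in> V" "d v \<le> d u"
  shows "card (N v - N u - {u}) \<le> t"
proof (cases "u = v")
  case False
  have le: "card (N v - N u) \<le> card (N u - N v)"
    using card_le_sym_Diff[OF finN finN] assms by blast
  have "card (N v - N u - {u}) \<le> card (N u - N v - {v})"
  proof (cases "u \<in> N v")
    case True
    then have "u \<in> N v - N u" "v \<in> N u - N v" using N_irrefl N_sym by auto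
    then show ?thesis using le by (simp add: card_Diff_singleton)
  next
    case F: False
    then have "v \<notin> N u" using N_sym by auto
    then show ?thesis using F le by simp
  qed
  then show ?thesis using dom[OF assms(1,2) False] by linarith
qed simp

lemma card_diff_le_Suc_of_degree_le:
  assumes "u \<in> V" "v \<in> V" "d v \<le> d u"
  shows "card (N v - N u) \<le> t + 1"
proof -
  have "card (N v - N u) \<le> card (insert u (N v - N u - {u}))"
    using finN assms by (intro card_mono) auto
  also have "\<dots> \<le> card (N v - N u - {u}) + 1"
    by (simp add: card_insert_if finN assms del: insert_Diff_single)
  finally show ?thesis using card_diff_le_of_degree_le[OF assms] by linarith
qed

text \<open>When \<open>v\<close> has the larger degree, the sizes of the two differences differ by
  exactly \<open>d v - d u\<close>, and the smaller is at most \<open>t + 1\<close>.\<close>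

lemma card_diff_le_of_degree_le_add:
  assumes "u \<in> V" "v \<in> V" "d v \<le> d u + c"
  shows "card (N v - N u) \<le> c + t + 1"
proof (cases "d v \<le> d u")
  case True
  then show ?thesis using card_diff_le_Suc_of_degree_le assms by fastforce
next
  case False
  have "card (N v - N u) + card (N v \<inter> N u) = d v"
    using card_Int_Diff[OF finN[OF assms(2)], of "N u"] by linarith
  moreover have "card (N u - N v) + card (N v \<inter> N u) = d u"
    using card_Int_Diff[OF finN[OF assms(1)], of "N v"] by (simp add: Int_commute)
  moreover have "card (N u - N v) \<le> t + 1"
    using card_diff_le_Suc_of_degree_le[of v u] assms False by simp
  ultimately show ?thesis using assms(3) by linarith
qed

end

section \<open>Deviations from the rank-degree rule\<close>

locale ranked_dominating_nbhds = dominating_nbhds +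
  fixes r :: "'a \<Rightarrow> nat"
  assumes r_bij: "bij_betw r V {..<card V}"
    and r_mono: "\<And>u v. u \<in> V \<Longrightarrow> v \<in> V \<Longrightarrow> r u < r v \<Longrightarrow> d v \<le> d u"
begin

lemma card_rank_vimage_le:
  assumes "finite I" shows "card {v \<in> V. r v \<in> I} \<le> card I"
proof (rule card_inj_on_le[OF _ _ assms])
  show "inj_on r {v \<in> V. r v \<in> I}"
    using r_bij by (auto simp: bij_betw_def inj_on_def)
qed auto

lemma card_rank_less:
  assumes "m \<le> card V" shows "card {v \<in> V. r v < m} = m"
proof -
  have inj: "inj_on r V" and im: "r ` V = {..<card V}"
    using r_bij by (auto simp: bij_betw_def)
  have "r ` {v \<in> V. r v < m} = {..<m}"
  proof (intro equalityI subsetI)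
    fix i assume i: "i \<in> {..<m}"
    then have "i \<in> r ` V" using im assms by auto
    then show "i \<in> r ` {v \<in> V. r v < m}" using i by auto
  qed auto
  moreover have "inj_on r {v \<in> V. r v < m}" using inj by (rule inj_on_subset) auto
  ultimately show ?thesis using card_image by fastforce
qed

lemma rank_less: "v \<in> V \<Longrightarrow> r v < card V"
  using r_bij by (auto simp: bij_betw_def)

text \<open>Deviation beyond this slack yields \<open>2 * t + 2\<close> entries, of which each
  exceptional column keeps at least \<open>t + 1\<close>. Against at most \<open>t\<close> per row
  this leaves at most \<open>2 * t\<close> columns, because
  \<open>(2 * t + 2) * t = 2 * t * (t + 1)\<close>.\<close>

abbreviation K :: nat where "K \<equiv> 2 * t + 1"

text \<open>
  In both bounds, \<open>k\<close> is an extremal exceptional column; its \<open>2 * t + 2\<close> surplus entries on the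
  wrong side of row \<open>a\<close> are nearly shared by all exceptional columns, whereas each row
  meets at most \<open>t\<close> of these.
\<close>

lemma card_nonneighbours_high_degree_le:
  assumes a: "a \<in> V"
  shows "card {j \<in> V. j \<notin> N a \<and> r a + K < d j} \<le> 2 * t + 1"
proof -
  define Z where "Z = {j \<in> V. j \<notin> N a \<and> r a + K < d j} - {a}"
  have fZ: "finite Z" and ZV: "Z \<subseteq> V" using finV by (auto simp: Z_def)
  have "card Z \<le> 2 * t"
  proof (cases "Z = {}")
    case False
    obtain k where k: "k \<in> Z" and kmin: "\<And>j. j \<in> Z \<Longrightarrow> d k \<le> d j"
      using ex_image_minimizer[OF fZ False, of d] by blast
    let ?after = "{b \<in> V. r a < r b}"
    \<comment> \<open>Since \<open>a\<close> is no neighbour of \<open>k\<close>, a neighbour of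
      \<open>k\<close> not after \<open>a\<close> is one of the \<open>r a\<close> vertices strictly
      before it.\<close>
    have "N k \<subseteq> (N k \<inter> ?after) \<union> {v \<in> V. r v < r a}"
    proof
      fix b assume b: "b \<in> N k"
      then have "b \<noteq> a" "b \<in> V" using k N_sym N_sub by (auto simp: Z_def)
      then have "r b \<noteq> r a" using r_bij a by (auto simp: bij_betw_def inj_on_def)
      then show "b \<in> (N k \<inter> ?after) \<union> {v \<in> V. r v < r a}"
        using b \<open>b \<in> V\<close> by auto
    qed
    then have "d k \<le> card ((N k \<inter> ?after) \<union> {v \<in> V. r v < r a})"
      using finV by (intro card_mono) auto
    also have "\<dots> \<le> card (N k \<inter> ?after) + r a"
      using card_Un_le[of "N k \<inter> ?after" "{v \<in> V. r v < r a}"]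
        card_rank_less[of "r a"] rank_less[OF a] by simp
    finally have "2 * t + 2 \<le> card (N k \<inter> ?after)" using k by (simp add: Z_def)
    then obtain P where P: "P \<subseteq> N k \<inter> ?after" "card P = 2 * t + 2" "finite P"
      using obtain_subset_with_card_n by blast
    have "card Z * (t + 1) \<le> card P * t"
    proof (rule double_count_le[where R = "\<lambda>j b. b \<in> N j"])
      fix j assume j: "j \<in> Z"
      have "P \<subseteq> {b \<in> P. b \<in> N j} \<union> (N k - N j - {j}) \<union> {j}" using P by auto
      then have "card P \<le> card ({b \<in> P. b \<in> N j} \<union> (N k - N j - {j}) \<union> {j})"
        using P finN k ZV by (intro card_mono) auto
      also have "\<dots> \<le> card {b \<in> P. b \<in> N j} + card (N k - N j - {j}) + card {j}"
        by (meson card_Un_le le_trans add_le_mono1)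
      also have "card (N k - N j - {j}) \<le> t"
        using card_diff_le_of_degree_le[of j k] j k kmin ZV by auto
      finally show "t + 1 \<le> card {b \<in> P. b \<in> N j}" using P by simp
    next
      fix b assume b: "b \<in> P"
      then have "b \<in> V" "d b \<le> d a" using P r_mono[OF a] by auto
      then have "card (N b - N a - {a}) \<le> t" using card_diff_le_of_degree_le a by blast
      moreover have "card {j \<in> Z. b \<in> N j} \<le> card (N b - N a - {a})"
        using finN[OF \<open>b \<in> V\<close>] N_sym by (intro card_mono) (auto simp: Z_def)
      ultimately show "card {j \<in> Z. b \<in> N j} \<le> t" by linarith
    qed (use fZ P in auto)
    then have "card Z * (t + 1) \<le> (2 * t) * (t + 1)" using P by (simp add: algebra_simps)
    then show ?thesis by (metis add_gr_0 mult_le_cancel2 zero_less_one)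
  qed simp
  moreover have "card {j \<in> V. j \<notin> N a \<and> r a + K < d j} \<le> card (insert a Z)"
    using fZ by (intro card_mono) (auto simp: Z_def)
  moreover have "card (insert a Z) \<le> card Z + 1" using fZ by (simp add: card_insert_if)
  ultimately show ?thesis by linarith
qed

lemma card_neighbours_low_degree_le:
  assumes a: "a \<in> V"
  shows "card {j \<in> N a. d j + K < r a} \<le> 2 * t"
proof -
  define Z where "Z = {j \<in> N a. d j + K < r a}"
  have fZ: "finite Z" and ZV: "Z \<subseteq> V" using finN[OF a] N_sub[OF a] by (auto simp: Z_def)
  have "card Z \<le> 2 * t"
  proof (cases "Z = {}")
    case False
    obtain k where k: "k \<in> Z" and kmax: "\<And>j. j \<in> Z \<Longrightarrow> d j \<le> d k"
      using ex_image_maximizer[OF fZ False, of d] by blast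
    have kV: "k \<in> V" using k ZV by auto
    let ?before = "{b \<in> V. r b < r a}"
    have "?before \<subseteq> (?before - N k - {k}) \<union> insert k (N k - {a})" by auto
    then have "card ?before \<le> card ((?before - N k - {k}) \<union> insert k (N k - {a}))"
      using finV finN[OF kV] by (intro card_mono) auto
    also have "\<dots> \<le> card (?before - N k - {k}) + card (insert k (N k - {a}))"
      by (rule card_Un_le)
    \<comment> \<open>Trading \<open>a\<close>, a neighbour of \<open>k\<close> outside
      \<open>?before\<close>, for \<open>k\<close> itself costs nothing.\<close>
    also have "card (insert k (N k - {a})) \<le> d k"
    proof -
      have "a \<in> N k" using k N_sym by (auto simp: Z_def)
      then have "card (N k - {a}) + 1 = d k"
        using finN[OF kV] by (metis Suc_eq_plus1 card_Suc_Diff1)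
      then show ?thesis using finN[OF kV] by (simp add: card_insert_if)
    qed
    finally have "2 * t + 2 \<le> card (?before - N k - {k})"
      using k card_rank_less[of "r a"] rank_less[OF a] by (simp add: Z_def)
    then obtain P where P: "P \<subseteq> ?before - N k - {k}" "card P = 2 * t + 2" "finite P"
      using obtain_subset_with_card_n by blast
    have "card Z * (t + 1) \<le> card P * t"
    proof (rule double_count_le[where R = "\<lambda>j b. b \<notin> N j \<and> b \<noteq> j"])
      fix j assume j: "j \<in> Z"
      have "P \<subseteq> {b \<in> P. b \<notin> N j \<and> b \<noteq> j} \<union> (N j - N k - {k}) \<union> {j}" using P by auto
      then have "card P \<le> card ({b \<in> P. b \<notin> N j \<and> b \<noteq> j} \<union> (N j - N k - {k}) \<union> {j})"
        using P finN j ZV by (intro card_mono) auto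
      also have "\<dots> \<le> card {b \<in> P. b \<notin> N j \<and> b \<noteq> j} + card (N j - N k - {k}) + card {j}"
        by (meson card_Un_le le_trans add_le_mono1)
      also have "card (N j - N k - {k}) \<le> t"
        using card_diff_le_of_degree_le[of k j] j kV kmax ZV by auto
      finally show "t + 1 \<le> card {b \<in> P. b \<notin> N j \<and> b \<noteq> j}" using P by simp
    next
      fix b assume b: "b \<in> P"
      then have "b \<in> V" "d a \<le> d b" using P r_mono[OF _ a] by auto
      then have "card (N a - N b - {b}) \<le> t" using card_diff_le_of_degree_le a by blast
      moreover have "card {j \<in> Z. b \<notin> N j \<and> b \<noteq> j} \<le> card (N a - N b - {b})"
        using finN[OF a] N_sym by (intro card_mono) (auto simp: Z_def)
      ultimately show "card {j \<in> Z. b \<notin> N j \<and> b \<noteq> j} \<le> t" by linarith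
    qed (use fZ P in auto)
    then have "card Z * (t + 1) \<le> (2 * t) * (t + 1)" using P by (simp add: algebra_simps)
    then show ?thesis by (metis add_gr_0 mult_le_cancel2 zero_less_one)
  qed simp
  then show ?thesis by (simp add: Z_def)
qed

section \<open>Corrected rows and the column weight\<close>

text \<open>Outside the band where \<open>d j\<close> and \<open>r a\<close> differ by at most
  \<open>K\<close>, membership depends only on these two numbers and favours earlier rows. A column
  in a later row but not in an earlier one thus lies in the bands of both.\<close>

definition B :: "'a \<Rightarrow> 'a set" where
  "B a = {j \<in> V. r a + K < d j \<or> (r a \<le> d j + K \<and> j \<in> N a)}"

lemma card_B_diff_le: "a \<in> V \<Longrightarrow> card (B a - N a) \<le> 2 * t + 1"
  by (rule order_trans[OF card_mono card_nonneighbours_high_degree_le])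
    (use finV in \<open>auto simp: B_def\<close>)

lemma card_diff_B_le: "a \<in> V \<Longrightarrow> card (N a - B a) \<le> 2 * t"
  by (rule order_trans[OF card_mono card_neighbours_low_degree_le])
    (use finN N_sub in \<open>auto simp: B_def\<close>)

definition s :: "'a \<Rightarrow> nat" where "s j = card {a \<in> V. j \<in> B a}"

text \<open>Rows containing \<open>j\<close> have rank at most \<open>d j + K\<close>; ranks start
  at 0, hence the \<open>+ 1\<close>.\<close>

lemma s_le: "s j \<le> d j + K + 1"
proof -
  have "s j \<le> card {a \<in> V. r a \<in> {..d j + K}}"
    unfolding s_def using finV by (intro card_mono) (auto simp: B_def)
  also have "\<dots> \<le> card {..d j + K}" by (rule card_rank_vimage_le) simp
  finally show ?thesis by simp
qed

lemma degree_le_s: assumes "j \<in> V" shows "d j \<le> s j + K"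
proof -
  have "d j - K \<le> card V" using card_mono[OF finV N_sub[OF assms]] by simp
  then have "d j - K = card {a \<in> V. r a < d j - K}" by (simp add: card_rank_less)
  also have "\<dots> \<le> s j"
    unfolding s_def using finV assms by (intro card_mono) (auto simp: B_def)
  finally show ?thesis by simp
qed

text \<open>Comparing degrees through \<open>s\<close> loses \<open>K + (K + 1) = 4 * t + 3\<close>,
  and passing to neighbourhoods a further \<open>t + 1\<close>.\<close>

abbreviation T :: nat where "T \<equiv> 5 * t + 4"

lemma card_diff_le_of_s_le:
  assumes "j \<in> V" "k \<in> V" "s k \<le> s j"
  shows "card (N k - N j) \<le> T"
proof -
  have "d k \<le> d j + (4 * t + 3)"
    using degree_le_s[OF assms(2)] s_le[of j] assms(3) by simp
  from card_diff_le_of_degree_le_add[OF assms(1,2) this] show ?thesis by simp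
qed

text \<open>At most \<open>2 * K\<close> nearby ranks on one side of a row, each contributing at
  most \<open>t + 1\<close> vertices.\<close>

abbreviation Q :: nat where "Q \<equiv> 2 * K * (t + 1)"

lemma card_UN_rank_le:
  assumes "card I \<le> 2 * K" "finite I"
    and "\<And>b. b \<in> V \<Longrightarrow> r b \<in> I \<Longrightarrow> card (X b) \<le> t + 1"
  shows "card (\<Union>b\<in>{b \<in> V. r b \<in> I}. X b) \<le> Q"
proof -
  have "card (\<Union>b\<in>{b \<in> V. r b \<in> I}. X b) \<le> (\<Sum>b\<in>{b \<in> V. r b \<in> I}. card (X b))"
    using finV by (intro card_UN_le) simp
  also have "\<dots> \<le> card {b \<in> V. r b \<in> I} * (t + 1)"
    using sum_bounded_above[of "{b \<in> V. r b \<in> I}" "\<lambda>b. card (X b)" "t + 1"] assms(3) by simp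
  also have "\<dots> \<le> Q"
    using card_rank_vimage_le[OF assms(2)] assms(1) by (intro mult_le_mono1) linarith
  finally show ?thesis .
qed

section \<open>Level sets approximating one neighbourhood\<close>

lemma ex_threshold_B:
  assumes a: "a \<in> V"
  shows "\<exists>\<theta>. card ({j \<in> V. \<theta> \<le> s j} - B a) \<le> Q \<and> card (B a - {j \<in> V. \<theta> \<le> s j}) \<le> Q"
proof -
  define X where "X = (\<Union>b\<in>{b \<in> V. r b \<in> {r a<..r a + 2 * K}}. N b - N a)"
  define Y where "Y = (\<Union>b\<in>{b \<in> V. r b \<in> {r a - 2 * K..<r a}}. N a - N b)"
  have XV: "finite X" using finV finN by (auto simp: X_def)
  have YV: "finite Y" using finV finN a by (auto simp: Y_def)
  have cX: "card X \<le> Q" unfolding X_def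
    using a r_mono by (intro card_UN_rank_le card_diff_le_Suc_of_degree_le) auto
  have cY: "card Y \<le> Q" unfolding Y_def
    using a r_mono by (intro card_UN_rank_le card_diff_le_Suc_of_degree_le) auto
  have inv: "j \<in> X \<or> k \<in> Y"
    if "j \<in> V" "j \<notin> B a" "k \<in> B a" "s k \<le> s j" for j k
  proof -
    have "\<exists>b\<in>V. j \<in> B b \<and> k \<notin> B b"
    proof (rule ccontr)
      assume "\<not> ?thesis"
      then have "{b \<in> V. j \<in> B b} \<subset> {b \<in> V. k \<in> B b}" using that a by blast
      then have "s j < s k" unfolding s_def using finV by (intro psubset_card_mono) auto
      then show False using that by simp
    qed
    then obtain b where b: "b \<in> V" "j \<in> B b" "k \<notin> B b" by blast
    have kV: "k \<in> V" using that by (simp add: B_def)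
    have "b \<noteq> a" using b that by auto
    then have "r b \<noteq> r a" using r_bij a b by (auto simp: bij_betw_def inj_on_def)
    then consider "r a < r b" | "r b < r a" by linarith
    then show ?thesis
    proof cases
      case 1
      \<comment> \<open>As \<open>j\<close> is missing from \<open>B a\<close>,
        \<open>d j \<le> r a + K\<close>. The later row \<open>b\<close> therefore contains
        \<open>j\<close> only by adjacency, so
        \<open>r b \<le> d j + K \<le> r a + 2 * K\<close>.\<close>
      then have "j \<in> N b - N a" "r b \<le> r a + 2 * K" using b that by (auto simp: B_def)
      then show ?thesis using b 1 by (auto simp: X_def)
    next
      case 2
      then have "k \<in> N a - N b" "r a - 2 * K \<le> r b" using b that kV by (auto simp: B_def)
      then show ?thesis using b 2 by (auto simp: Y_def)
    qed
  qed
  \<comment> \<open>With the least weight in \<open>B a - Y\<close>, the level set misses only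
    elements of \<open>Y\<close> and, by \<open>inv\<close>, adds only elements of \<open>X\<close>.
    If \<open>B a - Y\<close> is empty, the value exceeds every weight and the level set is
    empty.\<close>
  define \<theta> where "\<theta> = (if B a - Y = {} then Suc (Max (insert 0 (s ` V))) else Min (s ` (B a - Y)))"
  have fB: "finite (B a)" using finV by (simp add: B_def)
  have "B a - {j \<in> V. \<theta> \<le> s j} \<subseteq> Y"
    using fB by (auto simp: \<theta>_def B_def)
  moreover have "{j \<in> V. \<theta> \<le> s j} - B a \<subseteq> X"
  proof
    fix j assume j: "j \<in> {j \<in> V. \<theta> \<le> s j} - B a"
    have "B a - Y \<noteq> {}"
    proof
      assume "B a - Y = {}"
      moreover have "s j \<le> Max (insert 0 (s ` V))" using finV j by (intro Max_ge) auto
      ultimately show False using j by (simp add: \<theta>_def)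
    qed
    then have "\<theta> \<in> s ` (B a - Y)" using fB by (simp add: \<theta>_def)
    then obtain k where "k \<in> B a" "k \<notin> Y" "\<theta> = s k" by blast
    then show "j \<in> X" using inv[of j k] j by auto
  qed
  ultimately show ?thesis
    using card_mono[OF XV] card_mono[OF YV] cX cY by (meson order_trans)
qed

abbreviation E :: nat where "E \<equiv> Q + 2 * t + 1"

lemma ex_threshold:
  assumes a: "a \<in> V"
  shows "\<exists>\<theta>. card ({j \<in> V. \<theta> \<le> s j} - N a) \<le> E \<and> card (N a - {j \<in> V. \<theta> \<le> s j}) \<le> E"
proof -
  obtain \<theta> where th: "card ({j \<in> V. \<theta> \<le> s j} - B a) \<le> Q" "card (B a - {j \<in> V. \<theta> \<le> s j}) \<le> Q"
    using ex_threshold_B[OF a] by blast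
  let ?S = "{j \<in> V. \<theta> \<le> s j}"
  have fin: "finite ?S" "finite (B a)" using finV by (auto simp: B_def)
  have "card (?S - N a) \<le> card ((?S - B a) \<union> (B a - N a))"
    using fin by (intro card_mono) auto
  also have "\<dots> \<le> card (?S - B a) + card (B a - N a)" by (rule card_Un_le)
  finally have 1: "card (?S - N a) \<le> E" using th card_B_diff_le[OF a] by linarith
  have "card (N a - ?S) \<le> card ((N a - B a) \<union> (B a - ?S))"
    using fin finN[OF a] by (intro card_mono) auto
  also have "\<dots> \<le> card (N a - B a) + card (B a - ?S)" by (rule card_Un_le)
  finally have 2: "card (N a - ?S) \<le> E" using th card_diff_B_le[OF a] by linarith
  show ?thesis using 1 2 by blast
qed

section \<open>Monotone thresholds\<close>

text \<open>Take the least threshold over all vertices of weight at most \<open>x\<close>. For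
  \<open>s i\<close> it comes from some \<open>k\<close> with \<open>s k \<le> s i\<close>, and
  \<open>N k\<close> exceeds \<open>N i\<close> by at most \<open>T\<close> vertices; lowering a
  threshold loses no neighbours.\<close>

lemma ex_antimono_threshold:
  "\<exists>m :: nat \<Rightarrow> nat. antimono m \<and>
     (\<forall>i\<in>V. card ({j \<in> V. m (s i) \<le> s j} - N i) \<le> E + T \<and>
            card (N i - {j \<in> V. m (s i) \<le> s j}) \<le> E)"
proof -
  have "\<forall>a\<in>V. \<exists>\<theta>. card ({j \<in> V. \<theta> \<le> s j} - N a) \<le> E \<and> card (N a - {j \<in> V. \<theta> \<le> s j}) \<le> E"
    using ex_threshold by blast
  from bchoice[OF this] obtain \<theta> where th: "\<And>a. a \<in> V \<Longrightarrow> card ({j \<in> V. \<theta> a \<le> s j} - N a) \<le> E"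
      "\<And>a. a \<in> V \<Longrightarrow> card (N a - {j \<in> V. \<theta> a \<le> s j}) \<le> E"
    by blast
  \<comment> \<open>A default for weights \<open>x\<close> below every \<open>s i\<close>; being at
    least every threshold, it leaves the values at occurring weights unchanged.\<close>
  define M where "M = Max (insert 0 (\<theta> ` V))"
  define m where "m x = Min (insert M (\<theta> ` {i \<in> V. s i \<le> x}))" for x
  have "antimono m"
    unfolding antimono_def m_def using finV by (intro allI impI Min_antimono) auto
  moreover have "card ({j \<in> V. m (s i) \<le> s j} - N i) \<le> E + T \<and>
            card (N i - {j \<in> V. m (s i) \<le> s j}) \<le> E" if i: "i \<in> V" for i
  proof
    have thM: "\<theta> i \<le> M" unfolding M_def using i finV by (intro Max_ge) auto
    have le: "m (s i) \<le> \<theta> i" unfolding m_def using i finV by (intro Min_le) auto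
    have "m (s i) \<in> insert M (\<theta> ` {k \<in> V. s k \<le> s i})"
      unfolding m_def using finV by (intro Min_in) auto
    then have "m (s i) \<in> \<theta> ` {k \<in> V. s k \<le> s i}"
      using le thM i by (metis (mono_tags, lifting) imageI insertE le_antisym mem_Collect_eq order_refl)
    then obtain k where k: "k \<in> V" "s k \<le> s i" "m (s i) = \<theta> k" by blast
    let ?S = "{j \<in> V. m (s i) \<le> s j}"
    have "card (?S - N i) \<le> card ((?S - N k) \<union> (N k - N i))"
      using finV finN[OF k(1)] by (intro card_mono) auto
    also have "\<dots> \<le> card (?S - N k) + card (N k - N i)" by (rule card_Un_le)
    also have "\<dots> \<le> E + T"
      using th(1)[OF k(1)] k(3) card_diff_le_of_s_le[OF i k(1,2)] by (intro add_le_mono) auto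
    finally show "card (?S - N i) \<le> E + T" .
    have "card (N i - ?S) \<le> card (N i - {j \<in> V. \<theta> i \<le> s j})"
      using finN[OF i] le by (intro card_mono) auto
    then show "card (N i - ?S) \<le> E" using th(2)[OF i] by linarith
  qed
  ultimately show ?thesis by blast
qed

section \<open>Symmetrizing the thresholds\<close>

lemma ex_symmetric_monotone_relation:
  "\<exists>F :: nat \<Rightarrow> nat \<Rightarrow> bool.
     (\<forall>x y. F x y \<longrightarrow> F y x) \<and>
     (\<forall>x x' y. x \<le> x' \<longrightarrow> F x y \<longrightarrow> F x' y) \<and>
     (\<forall>i\<in>V. card (N i - {j \<in> V. F (s i) (s j)}) + card ({j \<in> V. F (s i) (s j)} - N i)
              \<le> 6 * E + 5 * T)"
proof -
  obtain m where anti: "antimono m"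
    and m1: "\<And>i. i \<in> V \<Longrightarrow> card ({j \<in> V. m (s i) \<le> s j} - N i) \<le> E + T"
    and m2: "\<And>i. i \<in> V \<Longrightarrow> card (N i - {j \<in> V. m (s i) \<le> s j}) \<le> E"
    using ex_antimono_threshold by blast
  \<comment> \<open>The relation \<open>m x \<le> y\<close> need not be nearly symmetric: many \<open>j\<close> may have a threshold
    that misses \<open>s i\<close> by a few vertices only. Allowing a gap of fewer than \<open>2 * E\<close> vertices
    repairs this, by counting non-edges between \<open>J\<close> and the gap below.\<close>
  define gap where "gap x y = {l \<in> V. y \<le> s l \<and> s l < m x}" for x y
  define R where "R x y \<longleftrightarrow> card (gap x y) < 2 * E" for x y
  define F where "F x y \<longleftrightarrow> R x y \<and> R y x" for x y
  have fin_gap: "finite (gap x y)" for x y using finV by (simp add: gap_def)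
  have gap_mono: "gap x' y' \<subseteq> gap x y" if "x \<le> x'" "y \<le> y'" for x x' y y'
    using antimonoD[OF anti that(1)] that(2) by (auto simp: gap_def)
  have R_mono: "R x' y'" if "x \<le> x'" "y \<le> y'" "R x y" for x x' y y'
    using card_mono[OF fin_gap gap_mono[OF that(1,2)]] that(3) unfolding R_def by linarith
  have err: "card (N i - {j \<in> V. F (s i) (s j)}) + card ({j \<in> V. F (s i) (s j)} - N i)
              \<le> 6 * E + 5 * T" if i: "i \<in> V" for i
  proof -
    let ?S = "{j \<in> V. m (s i) \<le> s j}"
    \<comment> \<open>\<open>L\<close> covers what \<open>F\<close> adds below the threshold of
      \<open>i\<close>; \<open>J\<close> is what it drops at or above it, where the test from the
      other side fails.\<close>
    define L where "L = {j \<in> V. s j < m (s i) \<and> R (s i) (s j)}"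
    define J where "J = {j \<in> ?S. \<not> R (s j) (s i)}"
    have fL: "finite L" and fJ: "finite J" using finV by (auto simp: L_def J_def)
    have cL: "card L \<le> 2 * E"
    proof (cases "L = {}")
      case False
      obtain j where j: "j \<in> L" and jmin: "\<And>l. l \<in> L \<Longrightarrow> s j \<le> s l"
        using ex_image_minimizer[OF fL False, of s] by blast
      have "L \<subseteq> gap (s i) (s j)" using jmin by (auto simp: L_def gap_def)
      then have "card L \<le> card (gap (s i) (s j))" by (intro card_mono fin_gap)
      then show ?thesis using j by (simp add: L_def R_def)
    qed simp
    have cJ: "card J \<le> 2 * (E + 2 * T)"
    proof (cases "J = {}")
      case False
      obtain q where q: "q \<in> J" and qmax: "\<And>l. l \<in> J \<Longrightarrow> s l \<le> s q"
        using ex_image_maximizer[OF fJ False, of s] by blast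
      let ?P = "gap (s q) (s i)"
      have P: "2 * E \<le> card ?P" using q by (simp add: J_def R_def)
      \<comment> \<open>Each \<open>j\<close> in \<open>J\<close> has at most \<open>E\<close>
        neighbours in \<open>?P\<close>, which lies below \<open>m (s q) \<le> m (s j)\<close>. Each
        \<open>l\<close> in \<open>?P\<close> has \<open>s i \<le> s l\<close>, hence misses at most
        \<open>T\<close> vertices of \<open>N i\<close>, and \<open>J\<close> exceeds
        \<open>N i\<close> by at most \<open>E + T\<close>. Finally \<open>card ?P - E\<close> is at
        least half of \<open>card ?P\<close>, as \<open>?P\<close> has at least \<open>2 * E\<close>
        vertices.\<close>
      have "card J * (card ?P - E) \<le> card ?P * (E + 2 * T)"
      proof (rule double_count_le[where R = "\<lambda>j l. l \<notin> N j"])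
        fix j assume j: "j \<in> J"
        then have jV: "j \<in> V" by (simp add: J_def)
        have "m (s q) \<le> m (s j)" using qmax[OF j] anti by (simp add: antimonoD)
        then have "?P \<subseteq> {l \<in> ?P. l \<notin> N j} \<union> (N j - {l \<in> V. m (s j) \<le> s l})"
          by (auto simp: gap_def)
        then have "card ?P \<le> card ({l \<in> ?P. l \<notin> N j} \<union> (N j - {l \<in> V. m (s j) \<le> s l}))"
          using fin_gap finN[OF jV] by (intro card_mono) auto
        also have "\<dots> \<le> card {l \<in> ?P. l \<notin> N j} + card (N j - {l \<in> V. m (s j) \<le> s l})"
          by (rule card_Un_le)
        finally show "card ?P - E \<le> card {l \<in> ?P. l \<notin> N j}" using m2[OF jV] by linarith
      next
        fix l assume l: "l \<in> ?P"
        then have lV: "l \<in> V" and sl: "s i \<le> s l" by (auto simp: gap_def)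
        have "card {j \<in> J. l \<notin> N j} \<le> card ((?S - N i) \<union> (N i - N l))"
          using finV finN[OF i] N_sym by (intro card_mono) (auto simp: J_def)
        also have "\<dots> \<le> card (?S - N i) + card (N i - N l)" by (rule card_Un_le)
        also have "\<dots> \<le> (E + T) + T"
          using m1[OF i] card_diff_le_of_s_le[OF lV i sl] by (rule add_le_mono)
        finally show "card {j \<in> J. l \<notin> N j} \<le> E + 2 * T" by simp
      qed (use fJ fin_gap in auto)
      moreover have "card J * card ?P \<le> card J * (2 * (card ?P - E))"
      proof (rule mult_le_mono2)
      have "c \<le> 2 * (c - e)" if "2 * e \<le> c" for c e :: nat using that by simp
      then show "card ?P \<le> 2 * (card ?P - E)" using P .
    qed
      ultimately have "card J * card ?P \<le> (2 * (E + 2 * T)) * card ?P"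
        by (simp add: algebra_simps)
      moreover have "0 < card ?P" by (rule less_le_trans[OF _ P]) simp
      ultimately show ?thesis using mult_le_cancel2 by blast
    qed simp
    have "card ({j \<in> V. F (s i) (s j)} - N i) \<le> card (L \<union> (?S - N i))"
      using fL finV by (intro card_mono) (auto simp: F_def L_def)
    also have "\<dots> \<le> card L + card (?S - N i)" by (rule card_Un_le)
    finally have A1: "card ({j \<in> V. F (s i) (s j)} - N i) \<le> 2 * E + (E + T)"
      using cL m1[OF i] by linarith
    have R_level: "R (s i) (s j)" if "j \<in> ?S" for j
    proof -
      have "gap (s i) (s j) = {}" using that by (auto simp: gap_def)
      then show ?thesis by (simp add: R_def)
    qed
    have "card (N i - {j \<in> V. F (s i) (s j)}) \<le> card ((N i - ?S) \<union> J)"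
      using fJ finN[OF i] R_level by (intro card_mono) (auto simp: F_def J_def)
    also have "\<dots> \<le> card (N i - ?S) + card J" by (rule card_Un_le)
    finally have "card (N i - {j \<in> V. F (s i) (s j)}) \<le> E + 2 * (E + 2 * T)"
      using cJ m2[OF i] by linarith
    \<comment> \<open>Dropped vertices number at most \<open>3 * E + 4 * T\<close>, added ones at
      most \<open>3 * E + T\<close>.\<close>
    from add_le_mono[OF this A1] show ?thesis by (simp add: algebra_simps)
  qed
  have "\<forall>x y. F x y \<longrightarrow> F y x" by (simp add: F_def)
  moreover have "\<forall>x x' y. x \<le> x' \<longrightarrow> F x y \<longrightarrow> F x' y" using R_mono by (auto simp: F_def)
  ultimately show ?thesis by (intro exI[of _ F] conjI ballI err)
qed

end

section \<open>Translation to and from graphs\<close>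

lemma dominating_nbhds_nbhd:
  assumes "pair_graph G" "t_dominating G t"
  shows "dominating_nbhds (pverts G) (nbhd G) t"
proof -
  interpret G: pair_graph G by fact
  have eq: "{w \<in> pverts G. w \<noteq> u \<and> w \<noteq> v \<and> w \<in> nbhd G v \<and> w \<notin> nbhd G u} =
      nbhd G v - nbhd G u - {u}" for u v
    using G.pair_no_loops by (fastforce simp: nbhd_def)
  show ?thesis
  proof
    show "card (nbhd G v - nbhd G u - {u}) \<le> t \<or> card (nbhd G u - nbhd G v - {v}) \<le> t"
      if "u \<in> pverts G" "v \<in> pverts G" "u \<noteq> v" for u v
    proof -
      have "t_dominates G t u v \<or> t_dominates G t v u"
        using assms(2) that by (simp add: t_dominating_def)
      then show ?thesis unfolding t_dominates_def eq .
    qed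
    show "v \<notin> nbhd G v" for v
      using G.pair_no_loops by (fastforce simp: nbhd_def)
    show "v \<in> nbhd G u" if "u \<in> nbhd G v" for u v
      using that G.arcs_symmetric G.in_arcsD1 by (auto simp: nbhd_def)
  qed (auto simp: nbhd_def G.pair_finite_verts)
qed

text \<open>By monotonicity every neighbour of a lighter vertex, except possibly the heavier vertex
  itself, is adjacent to the heavier one, and any two weights are comparable.\<close>

lemma weight_graph_properties:
  fixes s :: "'a \<Rightarrow> nat"
  assumes "finite V"
    and sym: "\<And>x y. F x y \<Longrightarrow> F y x"
    and mono: "\<And>x x' y. x \<le> x' \<Longrightarrow> F x y \<Longrightarrow> F x' y"
  defines "H \<equiv> \<lparr>pverts = V, parcs = {(u, v). u \<in> V \<and> v \<in> V \<and> u \<noteq> v \<and> F (s u) (s v)}\<rparr>"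
  shows "pair_graph H" and "t_dominating H 0"
proof -
  have fin: "finite (parcs H)"
    by (rule finite_subset[of _ "V \<times> V"]) (use assms(1) in \<open>auto simp: H_def\<close>)
  show "pair_graph H"
  proof
    show "finite (parcs H)" by (fact fin)
    show "symmetric H"
      using sym by (auto simp: H_def symmetric_def intro!: symI)
  qed (use assms(1) in \<open>auto simp: H_def\<close>)
  have nb: "nbhd H v = {w \<in> V. v \<in> V \<and> w \<noteq> v \<and> F (s v) (s w)}" for v
    by (auto simp: nbhd_def H_def)
  have dominates: "t_dominates H 0 u v" if "u \<in> V" "s v \<le> s u" for u v
  proof -
    have "{w \<in> pverts H. w \<noteq> u \<and> w \<noteq> v \<and> w \<in> nbhd H v \<and> w \<notin> nbhd H u} = {}"
      using mono[OF that(2)] that(1) by (auto simp: nb)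
    then show ?thesis unfolding t_dominates_def by (simp only: card.empty)
  qed
  show "t_dominating H 0"
    unfolding t_dominating_def
  proof (intro ballI impI)
    fix u v assume "u \<in> pverts H" "v \<in> pverts H"
    then have "u \<in> V" "v \<in> V" by (auto simp: H_def)
    then show "t_dominates H 0 u v \<or> t_dominates H 0 v u"
      using dominates linear[of "s u" "s v"] by blast
  qed
qed

theorem mainTheorem1:
  fixes G :: "'a pair_pre_digraph" and t :: nat
  assumes "pair_graph G" and "t_dominating G t"
  shows "\<exists>H :: 'a pair_pre_digraph. pair_graph H \<and> pverts H = pverts G \<and>
           t_dominating H 0 \<and> local_difference G H \<le> 646 * t ^ 4"
proof (cases "t = 0")
  case True
  \<comment> \<open>The bound is 0 here, so \<open>G\<close> itself has to serve as
    \<open>H\<close>.\<close>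
  have "local_difference G G = 0"
    unfolding local_difference_def by (rule Max_eqI) (use assms(1) in \<open>auto simp: pair_graph_def
      pair_digraph_def pair_fin_digraph_def pair_fin_digraph_axioms_def\<close>)
  then show ?thesis using assms True by auto
next
  case False
  interpret dominating_nbhds "pverts G" "nbhd G" t
    using dominating_nbhds_nbhd[OF assms] .
  obtain r where "bij_betw r (pverts G) {..<card (pverts G)}"
      "\<forall>u\<in>pverts G. \<forall>v\<in>pverts G. r u < r v \<longrightarrow> d v \<le> d u"
    using ex_rank_decreasing[OF finV, of d] by blast
  then interpret ranked_dominating_nbhds "pverts G" "nbhd G" t r
    by unfold_locales auto
  obtain F :: "nat \<Rightarrow> nat \<Rightarrow> bool"
    where sym: "\<And>x y. F x y \<Longrightarrow> F y x"
      and mono: "\<And>x x' y. x \<le> x' \<Longrightarrow> F x y \<Longrightarrow> F x' y"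
      and err: "\<And>i. i \<in> pverts G \<Longrightarrow>
        card (nbhd G i - {j \<in> pverts G. F (s i) (s j)}) +
        card ({j \<in> pverts G. F (s i) (s j)} - nbhd G i) \<le> 6 * E + 5 * T"
    using ex_symmetric_monotone_relation by blast
  define H where "H = \<lparr>pverts = pverts G,
    parcs = {(u, v). u \<in> pverts G \<and> v \<in> pverts G \<and> u \<noteq> v \<and> F (s u) (s v)}\<rparr>"
  have H: "pair_graph H" "t_dominating H 0"
    unfolding H_def by (rule weight_graph_properties[OF finV sym mono]; assumption)+
  \<comment> \<open>For \<open>t \<ge> 1\<close> each power below is at most \<open>t ^ 4\<close>,
    and the coefficients sum to 135.\<close>
  have bound: "6 * E + 5 * T \<le> 646 * t ^ 4"
  proof -
    have "t ^ 2 \<le> t ^ 4" "t ^ 1 \<le> t ^ 4" "t ^ 0 \<le> t ^ 4"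
      using False by (intro power_increasing; simp)+
    moreover have "6 * E + 5 * T = 24 * t ^ 2 + 73 * t ^ 1 + 38 * t ^ 0"
      by (simp add: power2_eq_square algebra_simps)
    ultimately show ?thesis by linarith
  qed
  have "card (nbhd G v - nbhd H v) + card (nbhd H v - nbhd G v) \<le> 646 * t ^ 4"
    if v: "v \<in> pverts G" for v
  proof -
    let ?S = "{j \<in> pverts G. F (s v) (s j)}"
    have nb: "nbhd H v = ?S - {v}" using v by (auto simp: nbhd_def H_def)
    have "card (nbhd G v - nbhd H v) \<le> card (nbhd G v - ?S)"
      using finN[OF v] N_irrefl by (intro card_mono) (auto simp: nb)
    moreover have "card (nbhd H v - nbhd G v) \<le> card (?S - nbhd G v)"
      using finV by (intro card_mono) (auto simp: nb)
    ultimately show ?thesis using err[OF v] bound by linarith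
  qed
  then have "local_difference G H \<le> 646 * t ^ 4"
    unfolding local_difference_def using finV by (subst Max_le_iff) auto
  moreover have "pverts H = pverts G" by (simp add: H_def)
  ultimately show ?thesis using H by blast
qed

end
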